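(* Let $s \in [0,1]$ and let $s = 0.a_1a_2\ldots$ be a (lower or upper) binary expansion of $s$. Then $$\alpha_{\inf}(u, s) = \liminf_{n \to \infty} \frac{\ln \| \vec{M}_{a_1 \ldots a_n} \|}{n \ln \left(\frac{1}{2}\right)} \qquad\text{and}\qquad \alpha_{\sup}(u, s) = \limsup_{n \to \infty} \frac{\ln \| \vec{M}_{a_1 \ldots a_n} \|}{n \ln \left(\frac{1}{2}\right)}.$$
   Context: Let $M_0 = \frac{1}{5}\begin{pmatrix} 5 & 2 & 2\\ 0 & 2 & 1\\ 0 & 1 & 2 \end{pmatrix}$ and $M_1 = \frac{1}{5}\begin{pmatrix} 2 & 0 & 1\\ 2 & 5 & 2\\ 1 & 0 & 2 \end{pmatrix}$, and let $h_0(x) = \frac{x}{2}$, $h_1(x) = \frac{x+1}{2}$. Let $u:[0,1]\to\mathbb{R}^3$ be the unique continuous function satisfying $u(0) = (1,0,0)^T$, $u(1) = (0,1,0)^T$, $u\circ h_0 = M_0\circ u$ and $u \circ h_1 = M_1\circ u$ on $[0,1]$ (this function is known to exist, to be unique, and to be injective). Let $\vec{\mathcal{H}} = \{(x,y,z)\in\mathbb{R}^3 : x+y+z=0\}$, which is stable by $M_0$ and $M_1$, and let $\vec{M}_i$ be the restriction of $M_i$ to $\vec{\mathcal{H}}$, for $i \in \{0,1\}$. For a finite word $a_1\ldots a_n$ on $\{0,1\}$, $\vec{M}_{a_1\ldots a_n} := \vec{M}_{a_1}\cdots\vec{M}_{a_n}$. $\|\cdot\|$ denotes any norm on the relevant finite-dimensional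 space (the statement holds for any choice of norms). For $s\in[0,1]$, the upper and lower Hölder exponents of $u$ in $s$ are $$\alpha_{\sup}(u, s) := \limsup_{t \to s,\ t \in [0, 1],\ t\neq s}\frac{\ln \|u(t) - u(s)\|}{\ln |t-s|},\qquad \alpha_{\inf}(u, s) := \liminf_{t \to s,\ t \in [0, 1],\ t\ne s}\frac{\ln \|u(t) - u(s)\|}{\ln |t-s|}.$$ For $s\in[0,1)$ (resp. $s\in(0,1]$), the upper (resp. lower) binary expansion of $s$ is the unique sequence $(a_i)_{i\ge1}$ in $\{0,1\}$ with $s = \sum_{i\ge1} a_i2^{-i}$ that does not end with an infinite sequence of $1$'s (resp. of $0$'s). *)

theory Defs
  imports "HOL-Analysis.Analysis"
begin

definition M :: "nat \<Rightarrow> real^3^3" where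
  "M i = (if i = 0
     then (1/5) *\<^sub>R vector [vector [5, 2, 2],
                            vector [0, 2, 1],
                            vector [0, 1, 2]]
     else (1/5) *\<^sub>R vector [vector [2, 0, 1],
                            vector [2, 5, 2],
                            vector [1, 0, 2]])"

definition H :: "(real^3) set" where
  "H = {v. v $ 1 + v $ 2 + v $ 3 = 0}"

text \<open>Functions are total, so the function on the unit interval is represented by any total
  function satisfying the conditions there; its values elsewhere are irrelevant.\<close>

definition is_curve :: "(real \<Rightarrow> real^3) \<Rightarrow> bool" where
  "is_curve u \<longleftrightarrow> continuous_on {0..1} u \<and>
     u 0 = vector [1, 0, 0] \<and> u 1 = vector [0, 1, 0] \<and>
     (\<forall>x\<in>{0..1}. u (x / 2) = M 0 *v u x) \<and>
     (\<forall>x\<in>{0..1}. u ((x + 1) / 2) = M 1 *v u x)"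

text \<open>Linear endomorphisms of the plane \<open>H\<close> are represented by extensional functions
  (\<open>undefined\<close> outside \<open>H\<close>), so that equality is equality on \<open>H\<close> and a norm on them sees
  nothing but the restriction to \<open>H\<close>.\<close>

definition End_H :: "(real^3 \<Rightarrow> real^3) set" where
  "End_H = {f \<in> H \<rightarrow>\<^sub>E H. (\<forall>v\<in>H. \<forall>w\<in>H. f (v + w) = f v + f w) \<and>
                         (\<forall>c. \<forall>v\<in>H. f (c *\<^sub>R v) = c *\<^sub>R f v)}"

definition Mvec :: "nat \<Rightarrow> real^3 \<Rightarrow> real^3" where
  "Mvec i = restrict (\<lambda>v. M i *v v) H"

fun Mvec_word :: "nat list \<Rightarrow> real^3 \<Rightarrow> real^3" where
  "Mvec_word [] = restrict (\<lambda>v. v) H"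
| "Mvec_word (i # w) = compose H (Mvec i) (Mvec_word w)"

lemma H_stable: "v \<in> H \<Longrightarrow> M i *v v \<in> H"
  by (simp add: H_def M_def matrix_vector_mult_def sum_3 vector_3 field_simps)

lemma H_add: "v \<in> H \<Longrightarrow> w \<in> H \<Longrightarrow> v + w \<in> H"
  by (simp add: H_def)

lemma H_scaleR: "v \<in> H \<Longrightarrow> c *\<^sub>R v \<in> H"
  by (simp add: H_def flip: distrib_left)

lemma Mvec_in_End_H: "Mvec i \<in> End_H"
  by (auto simp: End_H_def Mvec_def H_stable H_add H_scaleR matrix_vector_right_distrib
      matrix_vector_mult_scaleR)

lemma Mvec_word_in_End_H: "Mvec_word w \<in> End_H"
proof (induction w)
  case Nil
  show ?case
    by (auto simp: End_H_def H_add H_scaleR)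
next
  case (Cons i w)
  then show ?case
    using Mvec_in_End_H[of i]
    by (auto simp: End_H_def compose_def PiE_iff extensional_def H_add H_scaleR)
qed

text \<open>Norms on a real vector space given by its carrier, addition, scaling and zero; needed
  in this form because \<open>End_H\<close> is a set and not a type.\<close>

definition norm_on ::
  "'a set \<Rightarrow> ('a \<Rightarrow> 'a \<Rightarrow> 'a) \<Rightarrow> (real \<Rightarrow> 'a \<Rightarrow> 'a) \<Rightarrow> 'a \<Rightarrow> ('a \<Rightarrow> real) \<Rightarrow> bool" where
  "norm_on V add scl zero N \<longleftrightarrow>
     (\<forall>x\<in>V. 0 \<le> N x \<and> (N x = 0 \<longleftrightarrow> x = zero)) \<and>
     (\<forall>c. \<forall>x\<in>V. N (scl c x) = \<bar>c\<bar> * N x) \<and>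
     (\<forall>x\<in>V. \<forall>y\<in>V. N (add x y) \<le> N x + N y)"

definition norm_R3 :: "(real^3 \<Rightarrow> real) \<Rightarrow> bool" where
  "norm_R3 N \<longleftrightarrow> norm_on UNIV (+) (*\<^sub>R) 0 N"

definition norm_End_H :: "((real^3 \<Rightarrow> real^3) \<Rightarrow> real) \<Rightarrow> bool" where
  "norm_End_H N \<longleftrightarrow>
     norm_on End_H (\<lambda>f g. restrict (\<lambda>v. f v + g v) H) (\<lambda>c f. restrict (\<lambda>v. c *\<^sub>R f v) H)
       (restrict (\<lambda>v. 0) H) N"

text \<open>The filter \<open>at s within {0..1}\<close> excludes \<open>s\<close> itself. The limits are taken in the extended
  reals.\<close>

definition alpha_sup :: "(real^3 \<Rightarrow> real) \<Rightarrow> (real \<Rightarrow> real^3) \<Rightarrow> real \<Rightarrow> ereal" where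
  "alpha_sup N u s = Limsup (at s within {0..1}) (\<lambda>t. ereal (ln (N (u t - u s)) / ln \<bar>t - s\<bar>))"

definition alpha_inf :: "(real^3 \<Rightarrow> real) \<Rightarrow> (real \<Rightarrow> real^3) \<Rightarrow> real \<Rightarrow> ereal" where
  "alpha_inf N u s = Liminf (at s within {0..1}) (\<lambda>t. ereal (ln (N (u t - u s)) / ln \<bar>t - s\<bar>))"

text \<open>Digits are \<open>a 1, a 2, \<dots>\<close>; the value \<open>a 0\<close> is unused.\<close>

definition binary_digits :: "(nat \<Rightarrow> nat) \<Rightarrow> real \<Rightarrow> bool" where
  "binary_digits a s \<longleftrightarrow> (\<forall>i\<ge>1. a i \<in> {0, 1}) \<and>
     (\<lambda>i. real (a (Suc i)) * (1/2) ^ Suc i) sums s"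

definition upper_binary_expansion :: "(nat \<Rightarrow> nat) \<Rightarrow> real \<Rightarrow> bool" where
  "upper_binary_expansion a s \<longleftrightarrow>
     s \<in> {0..<1} \<and> binary_digits a s \<and> \<not> (\<exists>k. \<forall>i\<ge>k. a i = 1)"

definition lower_binary_expansion :: "(nat \<Rightarrow> nat) \<Rightarrow> real \<Rightarrow> bool" where
  "lower_binary_expansion a s \<longleftrightarrow>
     s \<in> {0<..1} \<and> binary_digits a s \<and> \<not> (\<exists>k. \<forall>i\<ge>k. a i = 0)"

end

theory Submission
  imports Defs
begin

text \<open>
  Seen through suitable coordinates the curve is monotone, and the theorem becomes the statement that
  the local exponents of an increasing function with a doubling property may be computed along the
  dyadic intervals around the point.

  The two matrices preserve a closed cone of the plane \<open>H\<close>, here called the sector, and act on it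
  by nonnegative matrices. The increment \<open>u 1 - u 0\<close>, called the chord, lies in the interior of the
  sector. By self-similarity the increment of \<open>u\<close> over the dyadic interval with address
  \<open>a\<^sub>1 \<dots> a\<^sub>n\<close> is the product \<open>M\<^bsub>a\<^sub>1\<dots>a\<^sub>n\<^esub>\<close> applied to the chord (\<open>increment_dyadic_index\<close>). Hence all
  these increments lie in the sector, and by density so does
  \<open>u y - u x\<close> whenever \<open>x \<le> y\<close> (\<open>u_increasing\<close>). On the sector every norm is
  equivalent to a linear functional, the width, so the norm of \<open>u t - u s\<close> is, up to constants, the variation of the increasing function
  \<open>u t $ 2 - u t $ 1\<close> between \<open>s\<close> and \<open>t\<close>.

  For the same reason the norm of \<open>M\<^bsub>a\<^sub>1\<dots>a\<^sub>n\<^esub>\<close> is comparable to the width of its image of the chord: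
  a nonnegative matrix is controlled by the sum of its entries (\<open>norm_End_H_width_bounds\<close>). So the right
  hand sides of the theorem describe the variation over the dyadic intervals containing \<open>s\<close>.

  A point \<open>t\<close> close to \<open>s\<close> need not share a dyadic interval of length about \<open>\<bar>t - s\<bar>\<close> with \<open>s\<close>. This
  is where the doubling property enters: the increments over two adjacent dyadic intervals of the same
  length differ by a factor of at most 4 (\<open>adjacent_increments\<close>). Consequently the variation between
  \<open>s\<close> and \<open>t\<close> is comparable to that over the dyadic interval of \<open>s\<close> at the scale of \<open>\<bar>t - s\<bar>\<close>, with
  absolute constants (\<open>width_at_scale\<close>). Constants disappear after taking logarithms and dividing by
  \<open>ln \<bar>t - s\<bar>\<close> (\<open>log_ratio_close\<close>), and the upper and lower limits over \<open>t\<close> agree with those over the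
  scales (\<open>limits_by_dyadic_scales\<close>).
\<close>

section \<open>Equivalence of norms\<close>

text \<open>A norm is convex, hence continuous on a finite-dimensional space, and so it is bounded and bounded
  away from zero on the compact unit sphere.\<close>

lemma norm_on_UNIV_equiv:
  fixes N :: "'a::euclidean_space \<Rightarrow> real"
  assumes "norm_on UNIV (+) (*\<^sub>R) 0 N"
  obtains c C where "0 < c" "0 < C" "\<And>x. c * norm x \<le> N x" "\<And>x. N x \<le> C * norm x"
proof -
  note ax = assms[unfolded norm_on_def]
  have nn: "0 \<le> N x" and z: "N x = 0 \<longleftrightarrow> x = 0" for x
    using ax by blast+
  have sc: "N (r *\<^sub>R x) = \<bar>r\<bar> * N x" for r x
    using ax by blast
  have tri: "N (x + y) \<le> N x + N y" for x y
    using ax by blast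
  have "convex_on UNIV N"
  proof (rule convex_onI)
    fix t :: real and x y assume "0 < t" "t < 1"
    then show "N ((1 - t) *\<^sub>R x + t *\<^sub>R y) \<le> (1 - t) * N x + t * N y"
      using tri[of "(1 - t) *\<^sub>R x" "t *\<^sub>R y"] by (simp add: sc)
  qed simp
  then have cont: "continuous_on (sphere 0 1) N"
    using convex_on_continuous[OF open_UNIV] continuous_on_subset by blast
  have ne: "sphere (0::'a) 1 \<noteq> {}" by simp
  obtain l where l: "l \<in> sphere 0 1" "\<And>x. x \<in> sphere 0 1 \<Longrightarrow> N l \<le> N x"
    using continuous_attains_inf[OF compact_sphere ne cont] by blast
  obtain h where h: "h \<in> sphere 0 1" "\<And>x. x \<in> sphere 0 1 \<Longrightarrow> N x \<le> N h"
    using continuous_attains_sup[OF compact_sphere ne cont] by blast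
  have pos: "0 < N l" "0 < N h"
    using l(1) h(1) nn[of l] nn[of h] z[of l] z[of h] by (auto simp: less_le)
  have *: "N l * norm x \<le> N x \<and> N x \<le> N h * norm x" for x
  proof (cases "x = 0")
    case False
    then have "sgn x \<in> sphere 0 1" by (simp add: norm_sgn)
    moreover have "N x = norm x * N (sgn x)"
      using False by (simp add: sgn_div_norm sc)
    ultimately show ?thesis
      using mult_left_mono[OF l(2), of "sgn x" "norm x"] mult_left_mono[OF h(2), of "sgn x" "norm x"]
      by (simp add: mult.commute)
  qed (use z[of 0] in simp)
  show thesis
    by (rule that[OF pos]) (use * in blast)+
qed

section \<open>The invariant sector\<close>

text \<open>The sector is the closed cone of \<open>H\<close> spanned by \<open>(-2, 1, 1)\<close> and \<open>(-1, 2, -1)\<close>, the eigenvectors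
  of \<open>M 0\<close> and \<open>M 1\<close> in \<open>H\<close> for the eigenvalue \<open>3/5\<close>. In this basis the two matrices are
  \<open>(1/5) [[3, 1], [0, 1]]\<close> and \<open>(1/5) [[1, 0], [1, 3]]\<close>. Their entries are nonnegative, which is
  what makes the sector invariant.\<close>

definition sector :: "(real^3) set" where
  "sector = {v \<in> H. v $ 1 \<le> v $ 3 \<and> v $ 3 \<le> v $ 2}"

text \<open>On the sector the width is three times the sum of the coordinates in the basis above: a linear
  functional that is equivalent there to any norm.\<close>

definition width :: "real^3 \<Rightarrow> real" where
  "width v = v $ 2 - v $ 1"

text \<open>This is \<open>u 1 - u 0\<close>, whose two coordinates in that basis are equal.\<close>

definition chord :: "real^3" where
  "chord = vector [-1, 1, 0]"

lemma M_0_components: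
  "5 * (M 0 *v v) $ 1 = 5 * v $ 1 + 2 * v $ 2 + 2 * v $ 3"
  "5 * (M 0 *v v) $ 2 = 2 * v $ 2 + v $ 3"
  "5 * (M 0 *v v) $ 3 = v $ 2 + 2 * v $ 3"
  by (simp_all add: M_def matrix_vector_mult_def sum_3)

lemma M_1_components:
  assumes "i \<noteq> 0"
  shows "5 * (M i *v v) $ 1 = 2 * v $ 1 + v $ 3"
    and "5 * (M i *v v) $ 2 = 2 * v $ 1 + 5 * v $ 2 + 2 * v $ 3"
    and "5 * (M i *v v) $ 3 = v $ 1 + 2 * v $ 3"
  using assms by (simp_all add: M_def matrix_vector_mult_def sum_3)

lemma sector_iff: "v \<in> sector \<longleftrightarrow> v $ 1 + v $ 2 + v $ 3 = 0 \<and> v $ 1 \<le> v $ 3 \<and> v $ 3 \<le> v $ 2"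
  by (simp add: sector_def H_def)

lemma M_sector:
  assumes "v \<in> sector"
  shows "M i *v v \<in> sector"
proof (cases "i = 0")
  case True
  then show ?thesis
    using assms M_0_components[of v] unfolding sector_iff by simp
next
  case False
  then show ?thesis
    using assms M_1_components[OF False, of v] unfolding sector_iff by simp
qed

lemma width_M_bounds:
  assumes "v \<in> sector"
  shows "2/5 * width v \<le> width (M i *v v) \<and> width (M i *v v) \<le> 3/5 * width v"
proof (cases "i = 0")
  case True
  then show ?thesis
    using assms M_0_components[of v] unfolding sector_iff width_def by simp
next
  case False
  then show ?thesis
    using assms M_1_components[OF False, of v] unfolding sector_iff width_def by simp
qed

lemma width_sector_nonneg: "v \<in> sector \<Longrightarrow> 0 \<le> width v"
  by (simp add: sector_def width_def)

lemma chord_in_sector: "chord \<in> sector" and width_chord: "width chord = 2"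
  by (simp_all add: chord_def sector_iff width_def)

lemma norm_R3_width_bounds:
  assumes "norm_R3 N"
  obtains c C where "0 < c" "0 < C"
    "\<And>v. v \<in> sector \<Longrightarrow> c * width v \<le> N v" "\<And>v. v \<in> sector \<Longrightarrow> N v \<le> C * width v"
proof -
  obtain c C where cC: "0 < c" "0 < C" "\<And>x. c * norm x \<le> N x" "\<And>x. N x \<le> C * norm x"
    using norm_on_UNIV_equiv assms unfolding norm_R3_def by metis
  have lo: "width v \<le> 2 * norm v" for v
    using component_le_norm_cart[of v 1] component_le_norm_cart[of v 2] by (simp add: width_def)
  \<comment> \<open>Vectors of the sector have \<open>v $ 1 \<le> 0 \<le> v $ 2\<close>, so all components are at most the width in size.\<close>
  have hi: "norm v \<le> 3 * width v" if "v \<in> sector" for v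
    using norm_le_l1_cart[of v] that by (auto simp: sum_3 sector_iff width_def)
  show thesis
  proof (rule that[of "c/2" "3*C"])
    fix v assume v: "v \<in> sector"
    have "c / 2 * width v \<le> c / 2 * (2 * norm v)"
      using lo[of v] cC(1) by (intro mult_left_mono) auto
    also have "\<dots> = c * norm v" by simp
    also have "\<dots> \<le> N v" by (rule cC(3))
    finally show "c / 2 * width v \<le> N v" .
    have "N v \<le> C * norm v" by (rule cC(4))
    also have "\<dots> \<le> C * (3 * width v)"
      using hi[OF v] cC(2) by (intro mult_left_mono) auto
    finally show "N v \<le> 3 * C * width v" by simp
  qed (use cC in auto)
qed

section \<open>Norms of endomorphisms that preserve the sector\<close>

text \<open>Coordinates of \<open>H\<close> in the spanning vectors of the sector divided by 3, so that both coordinates of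
  \<open>chord\<close> are 1. They make \<open>End_H\<close> a copy of the four-dimensional space of pairs of images of the two
  basis vectors, to which the equivalence of norms applies.\<close>

definition plane_vec :: "real \<times> real \<Rightarrow> real^3" where
  "plane_vec z = vector [- (2 * fst z + snd z) / 3, (fst z + 2 * snd z) / 3, (fst z - snd z) / 3]"

definition plane_coords :: "real^3 \<Rightarrow> real \<times> real" where
  "plane_coords v = (v $ 3 - v $ 1, v $ 2 - v $ 3)"

definition endo :: "(real \<times> real) \<times> (real \<times> real) \<Rightarrow> real^3 \<Rightarrow> real^3" where
  "endo z = restrict (\<lambda>v. fst (plane_coords v) *\<^sub>R plane_vec (fst z) +
                          snd (plane_coords v) *\<^sub>R plane_vec (snd z)) H"

lemma plane_vec_in_H: "plane_vec z \<in> H"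
  by (simp add: plane_vec_def H_def) argo

lemma plane_vec_coords: "v \<in> H \<Longrightarrow> plane_vec (plane_coords v) = v"
  unfolding H_def mem_Collect_eq vec_eq_iff forall_3 plane_vec_def plane_coords_def
  by (simp add: field_simps)

lemma plane_coords_vec: "plane_coords (plane_vec z) = z"
  unfolding plane_vec_def plane_coords_def prod_eq_iff
  by (simp add: field_simps)

lemma plane_vec_linear:
  "plane_vec (x + y) = plane_vec x + plane_vec y"
  "plane_vec (r *\<^sub>R x) = r *\<^sub>R plane_vec x"
  by (simp_all add: plane_vec_def vec_eq_iff forall_3 algebra_simps add_divide_distrib
      diff_divide_distrib)

lemma plane_coords_linear:
  "plane_coords (x + y) = plane_coords x + plane_coords y"
  "plane_coords (r *\<^sub>R x) = r *\<^sub>R plane_coords x"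
  by (auto simp: plane_coords_def algebra_simps)

lemma endo_in_End_H: "endo z \<in> End_H"
  by (auto simp: End_H_def endo_def H_add H_scaleR plane_vec_in_H plane_coords_linear
      scaleR_add_left scaleR_add_right)

lemma endo_images:
  "endo z (plane_vec (1, 0)) = plane_vec (fst z)"
  "endo z (plane_vec (0, 1)) = plane_vec (snd z)"
  by (simp_all add: endo_def plane_vec_in_H plane_coords_vec)

lemma endo_of_images:
  assumes "f \<in> End_H"
  shows "endo (plane_coords (f (plane_vec (1, 0))), plane_coords (f (plane_vec (0, 1)))) = f"
    (is "endo ?z = f")
proof
  fix v
  show "endo ?z v = f v"
  proof (cases "v \<in> H")
    case True
    let ?p = "fst (plane_coords v)" and ?q = "snd (plane_coords v)"
    have "v = plane_vec (?p *\<^sub>R (1, 0) + ?q *\<^sub>R (0, 1))"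
      by (simp add: plane_vec_coords[OF True])
    then have "v = ?p *\<^sub>R plane_vec (1, 0) + ?q *\<^sub>R plane_vec (0, 1)"
      by (metis plane_vec_linear)
    then have "f v = f (?p *\<^sub>R plane_vec (1, 0) + ?q *\<^sub>R plane_vec (0, 1))"
      by (rule arg_cong)
    also have "\<dots> = ?p *\<^sub>R f (plane_vec (1, 0)) + ?q *\<^sub>R f (plane_vec (0, 1))"
      using assms by (simp add: End_H_def plane_vec_in_H H_scaleR)
    also have "\<dots> = endo ?z v"
    proof -
      have "f (plane_vec z) \<in> H" for z
        using assms plane_vec_in_H[of z] unfolding End_H_def by blast
      then show ?thesis using True by (simp add: endo_def plane_vec_coords)
    qed
    finally show ?thesis ..
  next
    case False
    then show ?thesis
      using assms by (auto simp: endo_def End_H_def PiE_def extensional_def)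
  qed
qed

lemma norm_End_H_endo:
  assumes "norm_End_H N'"
  shows "norm_on UNIV (+) (*\<^sub>R) 0 (\<lambda>z. N' (endo z))"
proof -
  have add: "endo (x + y) = restrict (\<lambda>v. endo x v + endo y v) H" for x y
    by (auto simp: endo_def plane_vec_linear algebra_simps)
  have scl: "endo (r *\<^sub>R x) = restrict (\<lambda>v. r *\<^sub>R endo x v) H" for r x
    by (auto simp: endo_def plane_vec_linear algebra_simps)
  have z0: "plane_vec 0 = 0" by (metis plane_vec_linear(2) scaleR_zero_left)
  have zero: "endo x = restrict (\<lambda>v. 0) H \<longleftrightarrow> x = 0" for x
  proof
    assume *: "endo x = restrict (\<lambda>v. 0) H"
    have "plane_vec (fst x) = 0" "plane_vec (snd x) = 0"
      using endo_images[of x] by (simp_all add: * plane_vec_in_H)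
    then show "x = 0" by (metis plane_coords_vec z0 prod.collapse zero_prod_def)
  qed (simp add: endo_def z0)
  show ?thesis
    using assms endo_in_End_H unfolding norm_End_H_def norm_on_def
    by (simp add: add scl flip: zero)
qed

text \<open>An endomorphism that preserves the sector has a nonnegative matrix in the coordinates above. Its
  norm is therefore equivalent to the sum of its entries, and this sum is the width of its value at
  the vector \<open>chord\<close> with coordinates \<open>(1, 1)\<close>. So a single vector detects the whole norm: no
  cancellation occurs.\<close>

lemma norm_End_H_width_bounds:
  assumes "norm_End_H N'"
  obtains c C where "0 < c" "0 < C"
    "\<And>f. \<lbrakk>f \<in> End_H; f ` sector \<subseteq> sector\<rbrakk> \<Longrightarrow> c * width (f chord) \<le> N' f"
    "\<And>f. \<lbrakk>f \<in> End_H; f ` sector \<subseteq> sector\<rbrakk> \<Longrightarrow> N' f \<le> C * width (f chord)"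
proof -
  obtain c C where cC: "0 < c" "0 < C"
    "\<And>z. c * norm z \<le> N' (endo z)" "\<And>z. N' (endo z) \<le> C * norm z"
    using norm_on_UNIV_equiv[OF norm_End_H_endo[OF assms]] by metis
  have key: "\<exists>z. f = endo z \<and> norm z \<le> width (f chord) \<and> width (f chord) \<le> 4 * norm z"
    if f: "f \<in> End_H" "f ` sector \<subseteq> sector" for f
  proof -
    define x where "x = f (plane_vec (1, 0))"
    define y where "y = f (plane_vec (0, 1))"
    have "plane_vec (1, 0) \<in> sector" "plane_vec (0, 1) \<in> sector"
      by (simp_all add: sector_iff plane_vec_def)
    then have xy: "x \<in> sector" "y \<in> sector" using f(2) by (auto simp: x_def y_def)
    have chord: "chord = plane_vec (1, 0) + plane_vec (0, 1)"
      by (simp add: chord_def plane_vec_def vec_eq_iff forall_3)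
    have "f chord = x + y"
      using f(1) plane_vec_in_H unfolding End_H_def chord x_def y_def by blast
    then have w: "width (f chord) = width x + width y" by (simp add: width_def)
    let ?z = "(plane_coords x, plane_coords y)"
    have "norm ?z \<le> norm (plane_coords x) + norm (plane_coords y)" by (rule norm_Pair_le)
    also have "\<dots> \<le> width x + width y"
      using norm_Pair_le[of "x $ 3 - x $ 1" "x $ 2 - x $ 3"]
        norm_Pair_le[of "y $ 3 - y $ 1" "y $ 2 - y $ 3"] xy
      by (simp add: plane_coords_def sector_def width_def)
    finally have 1: "norm ?z \<le> width (f chord)" by (simp add: w)
    have "width v \<le> 2 * norm (plane_coords v)" for v
      using norm_fst_le[of "v $ 3 - v $ 1" "v $ 2 - v $ 3"]
        norm_snd_le[of "v $ 2 - v $ 3" "v $ 3 - v $ 1"]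
      by (simp add: plane_coords_def width_def)
    from this[of x] this[of y] have 2: "width (f chord) \<le> 4 * norm ?z"
      using norm_fst_le[of "plane_coords x" "plane_coords y"]
        norm_snd_le[of "plane_coords y" "plane_coords x"] by (simp add: w)
    show ?thesis
      using endo_of_images[OF f(1)] 1 2 unfolding x_def y_def by metis
  qed
  show thesis
  proof (rule that[of "c/4" C])
    fix f assume f: "f \<in> End_H" "f ` sector \<subseteq> sector"
    obtain z where z: "f = endo z" "norm z \<le> width (f chord)" "width (f chord) \<le> 4 * norm z"
      using key[OF f] by blast
    have "c / 4 * width (f chord) \<le> c / 4 * (4 * norm z)"
      using z(3) cC(1) by (intro mult_left_mono) auto
    also have "\<dots> = c * norm z" by simp
    also have "\<dots> \<le> N' f" by (rule cC(3)[of z, folded z(1)])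
    finally show "c / 4 * width (f chord) \<le> N' f" .
    have "N' f \<le> C * norm z" using cC(4)[of z] z(1) by simp
    also have "\<dots> \<le> C * width (f chord)"
      using z(2) cC(2) by (intro mult_left_mono) auto
    finally show "N' f \<le> C * width (f chord)" .
  qed (use cC in auto)
qed

section \<open>Increments over dyadic intervals\<close>

text \<open>Between dyadic points of one level the steps telescope; a real point is approximated at every level
  by the dyadic point below it.\<close>

lemma mono_of_dyadic_steps:
  fixes g :: "real \<Rightarrow> real"
  assumes cont: "continuous_on {0..1} g"
    and step: "\<And>n k. k < 2 ^ n \<Longrightarrow> g (real k / 2 ^ n) \<le> g (real (Suc k) / 2 ^ n)"
    and xy: "0 \<le> x" "x \<le> y" "y \<le> 1"
  shows "g x \<le> g y"
proof -
  have mono: "g (real i / 2 ^ n) \<le> g (real j / 2 ^ n)" if "i \<le> j" "j \<le> 2 ^ n" for i j n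
    using that
  proof (induction j rule: dec_induct)
    case (step k)
    then show ?case using assms(2)[of k n] by simp
  qed simp
  define r where "r = (\<lambda>(z::real) n. nat \<lfloor>2 ^ n * z\<rfloor>)"
  have r_bounds: "real (r z n) \<le> 2 ^ n * z \<and> 2 ^ n * z < real (r z n) + 1" if "0 \<le> z" for z n
    using that unfolding r_def by simp
  have r_lim: "(\<lambda>n. g (real (r z n) / 2 ^ n)) \<longlonglongrightarrow> g z" if z: "0 \<le> z" "z \<le> 1" for z
  proof -
    have hi: "real (r z n) / 2 ^ n \<le> z" for n
      using r_bounds[OF z(1), of n] by (simp add: divide_le_eq mult.commute)
    have lo: "z - (1/2) ^ n \<le> real (r z n) / 2 ^ n" for n
    proof -
      have "z - (1/2) ^ n = (2 ^ n * z - 1) / 2 ^ n"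
        by (simp add: power_one_over diff_divide_distrib)
      also have "\<dots> \<le> real (r z n) / 2 ^ n"
        using r_bounds[OF z(1), of n] by (intro divide_right_mono) auto
      finally show ?thesis .
    qed
    have "(\<lambda>n. z - (1/2) ^ n) \<longlonglongrightarrow> z - 0"
      by (intro tendsto_intros LIMSEQ_power_zero) simp
    then have lim: "(\<lambda>n. z - (1/2) ^ n) \<longlonglongrightarrow> z" by simp
    have "(\<lambda>n. real (r z n) / 2 ^ n) \<longlonglongrightarrow> z"
      by (rule tendsto_sandwich[OF _ _ lim tendsto_const]) (intro always_eventually allI lo hi)+
    moreover have "real (r z n) / 2 ^ n \<in> {0..1}" for n
      unfolding atLeastAtMost_iff using hi[of n] z by (meson divide_nonneg_nonneg of_nat_0_le_iff
          order_trans zero_le_numeral zero_le_power)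
    ultimately show ?thesis
      using cont z by (simp add: continuous_on_sequentially o_def)
  qed
  have le: "r x n \<le> r y n" "r y n \<le> 2 ^ n" for n
  proof -
    show "r x n \<le> r y n" using xy by (auto simp: r_def intro!: nat_mono floor_mono)
    have "2 ^ n * y \<le> 2 ^ n" using xy by simp
    then have "real (r y n) \<le> 2 ^ n" using r_bounds[of y n] xy by linarith
    then show "r y n \<le> 2 ^ n" by (metis of_nat_le_iff of_nat_numeral of_nat_power)
  qed
  show ?thesis
    by (rule LIMSEQ_le[OF r_lim r_lim]) (use xy mono le in auto)
qed

lemma dyadic_interval_exists:
  assumes "t \<in> {0..1}"
  obtains j where "j < 2 ^ n" "real j / 2 ^ n \<le> t" "t \<le> real (Suc j) / 2 ^ n"
proof (cases "t = 1")
  case True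
  then show thesis using that[of "2 ^ n - 1"] by (simp add: of_nat_diff)
next
  case False
  define j where "j = nat \<lfloor>2 ^ n * t\<rfloor>"
  have j: "real j \<le> 2 ^ n * t" "2 ^ n * t < real j + 1"
    using assms by (auto simp: j_def)
  have "2 ^ n * t < 2 ^ n" using False assms by auto
  then have "real j < 2 ^ n" using j(1) by linarith
  then have "j < 2 ^ n" by simp
  then show thesis
    using j by (intro that[of j]) (simp_all add: field_simps)
qed

locale curve =
  fixes u :: "real \<Rightarrow> real^3"
  assumes is_curve: "is_curve u"
begin

definition increment :: "nat \<Rightarrow> nat \<Rightarrow> real^3" where
  "increment n k = u (real (Suc k) / 2 ^ n) - u (real k / 2 ^ n)"

lemma increment_0: "increment 0 0 = chord"
  using is_curve by (simp add: is_curve_def increment_def chord_def vec_eq_iff forall_3)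

lemma u_half:
  assumes "x \<in> {0..1}"
  shows "u (x / 2) = M 0 *v u x" "u ((x + 1) / 2) = M 1 *v u x"
  using is_curve assms by (auto simp: is_curve_def)

lemma dyadic_in_unit: "k \<le> 2 ^ n \<Longrightarrow> real k / 2 ^ n \<in> {0..1}"
  by (simp add: divide_le_eq)

lemma increment_left:
  assumes "k < 2 ^ n"
  shows "increment (Suc n) k = M 0 *v increment n k"
proof -
  have *: "real j / 2 ^ Suc n = (real j / 2 ^ n) / 2" for j by simp
  show ?thesis
    unfolding increment_def * using assms
    by (simp only: u_half(1) dyadic_in_unit Suc_leI less_imp_le matrix_vector_mult_diff_distrib)
qed

lemma increment_right:
  assumes "k < 2 ^ n"
  shows "increment (Suc n) (2 ^ n + k) = M 1 *v increment n k"
proof -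
  have *: "real (2 ^ n + j) / 2 ^ Suc n = (real j / 2 ^ n + 1) / 2" for j
    by (simp add: field_simps)
  show ?thesis
    unfolding increment_def * add_Suc_right[symmetric] using assms
    by (simp only: u_half(2) dyadic_in_unit Suc_leI less_imp_le matrix_vector_mult_diff_distrib)
qed

lemma dyadic_index_cases:
  fixes k n :: nat
  assumes "k < 2 ^ Suc n"
  obtains "k < 2 ^ n" | j where "k = 2 ^ n + j" "j < 2 ^ n"
  using assms that by (cases "k < 2 ^ n") (auto dest!: le_Suc_ex simp: not_less)

lemma increment_in_sector: "k < 2 ^ n \<Longrightarrow> increment n k \<in> sector"
proof (induction n arbitrary: k)
  case 0
  then show ?case by (simp add: increment_0 chord_in_sector)
next
  case (Suc n)
  from Suc.prems show ?case
    by (cases rule: dyadic_index_cases)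
      (simp_all add: increment_left increment_right M_sector Suc.IH)
qed

lemma width_increment_bounds:
  assumes "k < 2 ^ n"
  shows "2 * (2/5) ^ n \<le> width (increment n k) \<and> width (increment n k) \<le> 2 * (3/5) ^ n"
  using assms
proof (induction n arbitrary: k)
  case 0
  then show ?case by (simp add: increment_0 width_chord)
next
  case (Suc n)
  obtain i j where ij: "j < 2 ^ n" "increment (Suc n) k = M i *v increment n j"
    using Suc.prems by (cases rule: dyadic_index_cases) (metis increment_left increment_right)+
  show ?case
    using Suc.IH[OF ij(1)] width_M_bounds[OF increment_in_sector[OF ij(1)], of i]
    unfolding ij(2) by simp
qed

text \<open>The curve is symmetric under \<open>t \<mapsto> 1 - t\<close> combined with the exchange of the first two
  components, which relates the first and the last increment of a level. The inequality says that
  the first increment leans towards the eigenvector of \<open>M 0\<close>.\<close>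

lemma extreme_increments:
  defines "v \<equiv> \<lambda>n. increment n 0" and "w \<equiv> \<lambda>n. increment n (2 ^ n - 1)"
  shows "w n $ 1 = - v n $ 2 \<and> w n $ 2 = - v n $ 1 \<and> w n $ 3 = - v n $ 3 \<and>
         v n $ 2 - v n $ 3 \<le> v n $ 3 - v n $ 1"
proof (induction n)
  case 0
  then show ?case by (simp add: v_def w_def increment_0 chord_def)
next
  case (Suc n)
  have v: "v (Suc n) = M 0 *v v n"
    by (simp add: v_def increment_left)
  have "2 ^ Suc n - 1 = 2 ^ n + (2 ^ n - 1 :: nat)" by simp
  then have w: "w (Suc n) = M 1 *v w n"
    unfolding w_def by (simp only:) (rule increment_right, simp)
  have "v n \<in> sector" by (simp add: v_def increment_in_sector)
  then show ?case
    using Suc M_0_components[of "v n"] M_1_components[of 1 "w n"] unfolding v w sector_iff by auto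
qed

text \<open>This is the doubling property. Two neighbours inside the same half of the unit interval inherit the
  comparison from the previous level because the matrices preserve the order defined by the sector.
  At the midpoint the symmetry of the extreme increments reduces the claim to coordinates: if
  \<open>(p, q)\<close> with \<open>p \<le> q\<close> is the last increment of the previous level, then the two increments are
  \<open>(3 p + q, q)/5\<close> and \<open>(q, 3 p + q)/5\<close>, and \<open>3 p + q \<le> 4 q\<close>.\<close>

lemma adjacent_increments:
  assumes "Suc k < 2 ^ n"
  shows "4 *\<^sub>R increment n k - increment n (Suc k) \<in> sector \<and>
         4 *\<^sub>R increment n (Suc k) - increment n k \<in> sector"
  using assms
proof (induction n arbitrary: k)
  case (Suc n)
  have lin: "4 *\<^sub>R (M i *v x) - M i *v y = M i *v (4 *\<^sub>R x - y)" for i x y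
    by (simp add: matrix_vector_mult_diff_distrib matrix_vector_mult_scaleR)
  consider "Suc k < 2 ^ n" | "k = 2 ^ n - 1" | j where "k = 2 ^ n + j" "Suc j < 2 ^ n"
  proof -
    assume cases: "Suc k < 2 ^ n \<Longrightarrow> thesis" "k = 2 ^ n - 1 \<Longrightarrow> thesis"
      "\<And>j. \<lbrakk>k = 2 ^ n + j; Suc j < 2 ^ n\<rbrakk> \<Longrightarrow> thesis"
    consider "Suc k < 2 ^ n" | "Suc k = 2 ^ n" | "2 ^ n \<le> k" by linarith
    then show thesis
      by cases (use cases(1,2) cases(3)[of "k - 2 ^ n"] Suc.prems in auto)
  qed
  then show ?case
  proof cases
    case 1
    then show ?thesis
      using Suc.IH[OF 1] by (simp add: increment_left lin M_sector)
  next
    case 2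
    have k: "increment (Suc n) k = M 0 *v increment n (2 ^ n - 1)"
      using 2 by (simp add: increment_left)
    have Suck: "increment (Suc n) (Suc k) = M 1 *v increment n 0"
      using increment_right[of 0 n] 2 by simp
    have "increment n 0 \<in> sector" by (simp add: increment_in_sector)
    then show ?thesis
      using extreme_increments[of n]
        M_0_components[of "increment n (2 ^ n - 1)"] M_1_components[of 1 "increment n 0"]
      unfolding k Suck sector_iff by simp
  next
    case 3
    then show ?thesis
      using Suc.IH[OF 3(2)] increment_right[of "Suc j" n] by (simp add: increment_right lin M_sector)
  qed
qed simp

text \<open>Each of the two sector coordinates of \<open>u\<close> is nondecreasing, and the sum of the components of \<open>u\<close>,
  being both nondecreasing and nonincreasing, is constant.\<close>

lemma u_increasing:
  assumes "0 \<le> x" "x \<le> y" "y \<le> 1"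
  shows "u y - u x \<in> sector"
proof -
  have cont: "continuous_on {0..1} u" using is_curve by (simp add: is_curve_def)
  have comp: "continuous_on {0..1} (\<lambda>t. u t $ i)" for i
    using cont by (intro continuous_intros)
  have sec: "u (real (Suc k) / 2 ^ n) - u (real k / 2 ^ n) \<in> sector" if "k < 2 ^ n" for k n
    using increment_in_sector[OF that] by (simp add: increment_def)
  have "u x $ 3 - u x $ 1 \<le> u y $ 3 - u y $ 1"
    by (rule mono_of_dyadic_steps[of "\<lambda>t. u t $ 3 - u t $ 1", OF _ _ assms])
      (use sec in \<open>fastforce simp: sector_iff intro!: continuous_intros comp\<close>)+
  moreover have "u x $ 2 - u x $ 3 \<le> u y $ 2 - u y $ 3"
    by (rule mono_of_dyadic_steps[of "\<lambda>t. u t $ 2 - u t $ 3", OF _ _ assms])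
      (use sec in \<open>fastforce simp: sector_iff intro!: continuous_intros comp\<close>)+
  moreover have "u x $ 1 + u x $ 2 + u x $ 3 \<le> u y $ 1 + u y $ 2 + u y $ 3"
    by (rule mono_of_dyadic_steps[of "\<lambda>t. u t $ 1 + u t $ 2 + u t $ 3", OF _ _ assms])
      (use sec in \<open>fastforce simp: sector_iff intro!: continuous_intros comp\<close>)+
  moreover have "- (u x $ 1 + u x $ 2 + u x $ 3) \<le> - (u y $ 1 + u y $ 2 + u y $ 3)"
    by (rule mono_of_dyadic_steps[of "\<lambda>t. - (u t $ 1 + u t $ 2 + u t $ 3)", OF _ _ assms])
      (use sec in \<open>fastforce simp: sector_iff intro!: continuous_intros comp\<close>)+
  ultimately show ?thesis by (simp add: sector_iff)
qed

end

section \<open>Words and binary digits\<close>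

text \<open>The number of the dyadic interval that consists of the points whose expansion starts with the given
  word, the most significant digit coming first.\<close>

fun dyadic_index :: "nat list \<Rightarrow> nat" where
  "dyadic_index [] = 0"
| "dyadic_index (i # w) = i * 2 ^ length w + dyadic_index w"

lemma dyadic_index_less: "set w \<subseteq> {0, 1} \<Longrightarrow> dyadic_index w < 2 ^ length w"
  by (induction w) auto

lemma Mvec_word_Cons: "v \<in> H \<Longrightarrow> Mvec_word (i # w) v = M i *v Mvec_word w v"
  using Mvec_word_in_End_H[of w] by (auto simp: compose_def Mvec_def End_H_def)

lemma Mvec_word_sector: "Mvec_word w ` sector \<subseteq> sector"
proof (induction w)
  case (Cons i w)
  have "Mvec_word (i # w) v \<in> sector" if "v \<in> sector" for v
    using that Cons M_sector[of "Mvec_word w v" i] Mvec_word_Cons[of v i w]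
    by (auto simp: sector_def image_subset_iff simp del: Mvec_word.simps)
  then show ?case by blast
qed (auto simp: sector_def)

text \<open>This links the two sides of the theorem: the matrix product along a word, applied to the chord, is
  the increment of \<open>u\<close> over the dyadic interval of the word.\<close>

lemma (in curve) increment_dyadic_index:
  "set w \<subseteq> {0, 1} \<Longrightarrow> increment (length w) (dyadic_index w) = Mvec_word w chord"
proof (induction w)
  case Nil
  then show ?case using chord_in_sector by (simp add: increment_0 sector_def)
next
  case (Cons i w)
  then have "dyadic_index w < 2 ^ length w" "i = 0 \<or> i = 1"
    "increment (length w) (dyadic_index w) = Mvec_word w chord"
    using dyadic_index_less by auto
  moreover have "chord \<in> H" using chord_in_sector by (simp add: sector_def)
  ultimately show ?case
    by (auto simp: Mvec_word_Cons increment_left increment_right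
        simp del: Mvec_word.simps)
qed

lemma binary_digits_shift:
  assumes "binary_digits a s"
  shows "binary_digits (\<lambda>i. a (Suc i)) (2 * s - real (a 1))"
proof -
  have "(\<lambda>i. real (a (Suc i)) * (1/2) ^ Suc i) sums s"
    using assms by (simp add: binary_digits_def)
  then have "(\<lambda>i. real (a (Suc (Suc i))) * (1/2) ^ Suc (Suc i)) sums (s - real (a 1) / 2)"
    by (subst sums_Suc_iff) simp
  then have "(\<lambda>i. 2 * (real (a (Suc (Suc i))) * (1/2) ^ Suc (Suc i))) sums
      (2 * (s - real (a 1) / 2))"
    by (rule sums_mult)
  then show ?thesis
    using assms by (simp add: binary_digits_def algebra_simps)
qed

lemma binary_digits_unit_interval:
  assumes "binary_digits a s"
  shows "0 \<le> s" "s \<le> 1"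
proof -
  have sums: "(\<lambda>i. real (a (Suc i)) * (1/2) ^ Suc i) sums s" and dig: "a (Suc i) \<in> {0, 1}" for i
    using assms by (auto simp: binary_digits_def)
  show "0 \<le> s" by (rule sums_le[OF _ sums_zero sums]) simp
  have "real (a (Suc i)) * (1/2) ^ Suc i \<le> (1/2) ^ Suc i" for i
    using dig[of i] by auto
  then show "s \<le> 1" by (rule sums_le[OF _ sums power_half_series])
qed

text \<open>The intervals are closed, so a dyadic point belongs to two intervals of its level and either of its
  expansions selects one of them.\<close>

lemma dyadic_interval_of_digits:
  assumes "binary_digits a s"
  defines "k \<equiv> \<lambda>n. dyadic_index (map a [1..<Suc n])"
  shows "real (k n) / 2 ^ n \<le> s \<and> s \<le> real (Suc (k n)) / 2 ^ n"
  using assms(1) unfolding k_def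
proof (induction n arbitrary: a s)
  case 0
  then show ?case using binary_digits_unit_interval[of a s] by simp
next
  case (Suc n)
  let ?j = "dyadic_index (map (\<lambda>i. a (Suc i)) [1..<Suc n])"
  have "[1..<Suc (Suc n)] = 1 # map Suc [1..<Suc n]"
    by (simp add: map_Suc_upt upt_conv_Cons del: upt_Suc)
  then have "map a [1..<Suc (Suc n)] = a 1 # map (\<lambda>i. a (Suc i)) [1..<Suc n]"
    by (simp del: upt_Suc add: o_def)
  then have k: "dyadic_index (map a [1..<Suc (Suc n)]) = a 1 * 2 ^ n + ?j"
    by (simp del: upt_Suc)
  show ?case
    using Suc.IH[OF binary_digits_shift[OF Suc.prems]] unfolding k
    by (simp add: field_simps del: upt_Suc)
qed

section \<open>The increment of the curve at a given scale\<close>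

context curve
begin

lemma width_adjacent_increments:
  assumes "Suc k < 2 ^ n"
  shows "width (increment n (Suc k)) \<le> 4 * width (increment n k)"
    and "width (increment n k) \<le> 4 * width (increment n (Suc k))"
  using adjacent_increments[OF assms] by (auto simp: sector_iff width_def)

lemma width_nearby_increments:
  assumes "k < 2 ^ n" "j < 2 ^ n" "j \<le> k + l" "k \<le> j + l"
  shows "width (increment n j) \<le> 4 ^ l * width (increment n k)"
  using assms(2-)
proof (induction l arbitrary: j)
  case (Suc l)
  have nonneg: "0 \<le> 4 ^ l * width (increment n k)"
    using increment_in_sector[OF assms(1)] width_sector_nonneg by simp
  consider "j \<le> k + l" "k \<le> j + l" | "j = Suc (k + l)" | "k = Suc (j + l)"
    using Suc.prems by linarith
  then show ?case
  proof cases
    case 1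
    then show ?thesis using Suc.IH[OF Suc.prems(1) 1] nonneg by simp
  next
    case 2
    then show ?thesis
      using Suc.IH[of "k + l"] width_adjacent_increments(1)[of "k + l" n] Suc.prems by simp
  next
    case 3
    then show ?thesis
      using Suc.IH[of "Suc j"] width_adjacent_increments(2)[of j n] assms(1) by simp
  qed
qed simp

lemma width_u_mono:
  assumes "0 \<le> x" "x \<le> x'" "x' \<le> y'" "y' \<le> y" "y \<le> 1"
  shows "width (u y' - u x') \<le> width (u y - u x)"
  using width_sector_nonneg[OF u_increasing[of x x']] width_sector_nonneg[OF u_increasing[of y' y]] assms
  by (simp add: width_def)

lemma width_dyadic_difference:
  assumes "i \<le> j"
  shows "width (u (real j / 2 ^ n) - u (real i / 2 ^ n)) = (\<Sum>k = i..<j. width (increment n k))"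
  using assms by (induction j rule: dec_induct) (simp_all add: increment_def width_def)

text \<open>If \<open>\<bar>t - s\<bar>\<close> lies between \<open>2/2 ^ n\<close> and \<open>4/2 ^ n\<close>, the points between \<open>s\<close> and \<open>t\<close> contain a
  whole neighbour of the dyadic interval of \<open>s\<close>, and they are covered by that interval and four
  further ones in a row. By the doubling property all of these have increments comparable to that of the
  interval of \<open>s\<close>, and by monotonicity they bound the increment between \<open>s\<close> and \<open>t\<close>.\<close>

lemma width_at_scale:
  assumes k: "k < 2 ^ n" "real k / 2 ^ n \<le> s" "s \<le> real (Suc k) / 2 ^ n"
    and s: "s \<in> {0..1}" and t: "t \<in> {0..1}"
    and d: "2 / 2 ^ n \<le> \<bar>t - s\<bar>" "\<bar>t - s\<bar> < 4 / 2 ^ n"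
  shows "1/4 * width (increment n k) \<le> width (u (max s t) - u (min s t))"
    and "width (u (max s t) - u (min s t)) \<le> 1280 * width (increment n k)"
proof -
  let ?w = "width (increment n k)"
  have scaled: "real k \<le> 2 ^ n * s" "2 ^ n * s \<le> real k + 1"
    using k by (simp_all add: field_simps)
  have "\<bar>2 ^ n * t - 2 ^ n * s\<bar> = 2 ^ n * \<bar>t - s\<bar>"
    by (simp add: abs_mult flip: right_diff_distrib)
  then have d': "2 \<le> \<bar>2 ^ n * t - 2 ^ n * s\<bar>" "\<bar>2 ^ n * t - 2 ^ n * s\<bar> < 4"
    using d by (simp_all add: divide_le_eq less_divide_eq mult.commute)
  have t': "0 \<le> 2 ^ n * t" "2 ^ n * t \<le> 2 ^ n"
    using t by auto
  show "1/4 * ?w \<le> width (u (max s t) - u (min s t))"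
  proof (cases "s < t")
    case True
    then have lt: "real (k + 2) \<le> 2 ^ n * t"
      using d'(1) scaled by (simp add: abs_if split: if_splits)
    then have "real (k + 2) \<le> 2 ^ n" using t' by linarith
    then have "real (k + 2) \<le> real (2 ^ n)" by (simp only: of_nat_power of_nat_numeral)
    then have k2: "Suc k < 2 ^ n" unfolding of_nat_le_iff by simp
    have "?w \<le> 4 * width (increment n (Suc k))"
      by (rule width_adjacent_increments(2)[OF k2])
    also have "width (increment n (Suc k)) \<le> width (u t - u s)"
      unfolding increment_def using lt k(3) s t
      by (intro width_u_mono) (auto simp: field_simps)
    finally show ?thesis using True by (simp add: max_def min_def)
  next
    case False
    then have lt: "2 ^ n * t \<le> real k - 1"
      using d'(1) scaled by (simp add: abs_if split: if_splits)
    then obtain j where j: "k = Suc j" using t' by (cases k) auto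
    have "?w \<le> 4 * width (increment n j)"
      using width_adjacent_increments(1)[of j n] k(1) j by simp
    also have "width (increment n j) \<le> width (u s - u t)"
      unfolding increment_def using lt k(2) s t j
      by (intro width_u_mono) (auto simp: field_simps)
    finally show ?thesis using False by (simp add: max_absorb1 min_absorb2)
  qed
  obtain j where j: "j < 2 ^ n" "real j / 2 ^ n \<le> t" "t \<le> real (Suc j) / 2 ^ n"
    using dyadic_interval_exists[OF t] by blast
  have "real j \<le> 2 ^ n * t" "2 ^ n * t \<le> real j + 1"
    using j by (simp_all add: field_simps)
  then have "real j < real (k + 5)" "real k < real (j + 5)"
    using scaled d'(2) unfolding of_nat_add of_nat_numeral by linarith+
  then have jk: "j \<le> k + 4" "k \<le> j + 4" by linarith+
  \<comment> \<open>The dyadic points \<open>a/2 ^ n\<close> and \<open>b/2 ^ n\<close> enclose \<open>s\<close> and \<open>t\<close> and are at most five steps apart.\<close>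
  define a b where "a = min j k" and "b = Suc (max j k)"
  have ab: "a \<le> b" "b \<le> a + 5" "b \<le> 2 ^ n"
    using jk j(1) k(1) by (auto simp: a_def b_def)
  have b1: "real b / 2 ^ n \<le> 1" using dyadic_in_unit[OF ab(3)] by simp
  have a1: "real a / 2 ^ n \<le> min s t" and b2: "max s t \<le> real b / 2 ^ n"
  proof -
    have le: "real x / 2 ^ n \<le> real y / 2 ^ n" if "x \<le> y" for x y :: nat
      using that by (simp add: divide_right_mono)
    show "real a / 2 ^ n \<le> min s t"
      using le[of a j] le[of a k] j(2) k(2) by (simp add: a_def)
    show "max s t \<le> real b / 2 ^ n"
      using le[of "Suc j" b] le[of "Suc k" b] j(3) k(3) by (simp add: b_def)
  qed
  have w0: "0 \<le> ?w" using increment_in_sector[OF k(1)] by (rule width_sector_nonneg)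
  have "width (u (max s t) - u (min s t)) \<le> width (u (real b / 2 ^ n) - u (real a / 2 ^ n))"
    using a1 b1 b2 by (intro width_u_mono) auto
  also have "\<dots> = (\<Sum>i = a..<b. width (increment n i))"
    by (rule width_dyadic_difference[OF ab(1)])
  also have "\<dots> \<le> of_nat (card {a..<b}) * (4 ^ 4 * ?w)"
  proof (rule sum_bounded_above)
    fix i assume "i \<in> {a..<b}"
    then have "i < 2 ^ n" "i \<le> k + 4" "k \<le> i + 4"
      using jk ab(3) by (auto simp: a_def b_def)
    then show "width (increment n i) \<le> 4 ^ 4 * ?w"
      by (intro width_nearby_increments k(1))
  qed
  also have "\<dots> \<le> 5 * (4 ^ 4 * ?w)"
    using ab w0 by (intro mult_right_mono) auto
  finally show "width (u (max s t) - u (min s t)) \<le> 1280 * ?w" by simp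
qed

end

section \<open>Upper and lower limits along dyadic scales\<close>

text \<open>If \<open>h\<close> is asymptotically \<open>f\<close> read along the map \<open>g\<close>, then every limit value of \<open>h\<close> is a limit
  value of \<open>f\<close>.\<close>

lemma Limsup_le_of_asymptotic:
  fixes f :: "'a \<Rightarrow> real" and h :: "'b \<Rightarrow> real"
  assumes g: "filterlim g F G" and lim: "((\<lambda>x. f (g x) - h x) \<longlongrightarrow> 0) G" and G: "G \<noteq> bot"
  shows "Limsup G (\<lambda>x. ereal (h x)) \<le> Limsup F (\<lambda>x. ereal (f x))"
proof (rule ereal_le_epsilon2)
  fix e :: real assume e: "0 < e"
  have "\<forall>\<^sub>F x in G. dist (f (g x) - h x) 0 < e"
    using lim e by (rule tendstoD)
  then have "\<forall>\<^sub>F x in G. ereal (h x) \<le> ereal (f (g x)) + ereal e"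
    by eventually_elim (simp add: dist_real_def abs_less_iff)
  then have "Limsup G (\<lambda>x. ereal (h x)) \<le> Limsup G (\<lambda>x. ereal (f (g x)) + ereal e)"
    by (rule Limsup_mono)
  also have "\<dots> = Limsup G (\<lambda>x. ereal (f (g x))) + ereal e"
    using G by (intro Limsup_add_ereal_right) auto
  also have "Limsup G (\<lambda>x. ereal (f (g x))) \<le> Limsup (filtermap g G) (\<lambda>x. ereal (f x))"
    by (rule Limsup_filtermap_ge)
  also have "Limsup (filtermap g G) (\<lambda>x. ereal (f x)) \<le> Limsup F (\<lambda>x. ereal (f x))"
    unfolding Limsup_def
    by (rule INF_superset_mono) (use g in \<open>auto simp: filterlim_def le_filter_def\<close>)
  finally show "Limsup G (\<lambda>x. ereal (h x)) \<le> Limsup F (\<lambda>x. ereal (f x)) + ereal e"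
    by (simp add: add_right_mono)
qed

lemma Liminf_ge_of_asymptotic:
  fixes f :: "'a \<Rightarrow> real" and h :: "'b \<Rightarrow> real"
  assumes g: "filterlim g F G" and lim: "((\<lambda>x. f (g x) - h x) \<longlongrightarrow> 0) G" and G: "G \<noteq> bot"
  shows "Liminf F (\<lambda>x. ereal (f x)) \<le> Liminf G (\<lambda>x. ereal (h x))"
proof -
  have "((\<lambda>x. - f (g x) - - h x) \<longlongrightarrow> 0) G"
    using tendsto_minus[OF lim] by simp
  from Limsup_le_of_asymptotic[of g F G "\<lambda>x. - f x" "\<lambda>x. - h x", OF g this G]
  show ?thesis
    by (simp add: ereal_Limsup_uminus flip: uminus_ereal.simps(1))
qed

text \<open>For \<open>0 < d \<le> 1\<close> this is the level \<open>n\<close> for which \<open>d\<close> lies between \<open>2/2 ^ n\<close> (included) and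
  \<open>4/2 ^ n\<close> (excluded).\<close>

definition scale :: "real \<Rightarrow> nat" where
  "scale d = nat \<lceil>1 - log 2 d\<rceil>"

lemma scale_bounds:
  assumes "0 < d" "d \<le> 1"
  shows "2 / 2 ^ scale d \<le> d" "d < 4 / 2 ^ scale d"
proof -
  have "log 2 d \<le> 0" using assms by simp
  then have n: "1 - log 2 d \<le> real (scale d)" "real (scale d) < 2 - log 2 d"
    unfolding scale_def by linarith+
  have d: "d = 2 powr log 2 d" using assms by simp
  have "2 / 2 ^ scale d = 2 powr (1 - real (scale d))"
    by (simp add: powr_diff powr_realpow)
  also have "\<dots> \<le> 2 powr log 2 d"
    using n by (intro powr_mono) auto
  finally show "2 / 2 ^ scale d \<le> d" using d by simp
  have "2 powr log 2 d < 2 powr (2 - real (scale d))"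
    using n by (intro powr_less_mono) auto
  also have "\<dots> = 4 / 2 ^ scale d"
    by (simp add: powr_diff powr_realpow)
  finally show "d < 4 / 2 ^ scale d" using d by simp
qed

text \<open>The limits are compared in both directions. Every \<open>t\<close> near \<open>s\<close> has a scale, which tends to
  infinity as \<open>t\<close> approaches \<open>s\<close>; conversely every fine scale is attained by a point of the unit interval,
  to the right or to the left of \<open>s\<close> according to where there is room.\<close>

lemma limits_by_dyadic_scales:
  fixes f :: "real \<Rightarrow> real" and h :: "nat \<Rightarrow> real"
  assumes s: "s \<in> {0..1}" and err: "err \<longlonglongrightarrow> 0"
    and close: "\<And>n t. \<lbrakk>n \<ge> 3; t \<in> {0..1}; 2 / 2 ^ n \<le> \<bar>t - s\<bar>; \<bar>t - s\<bar> < 4 / 2 ^ n\<rbrakk>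
      \<Longrightarrow> \<bar>f t - h n\<bar> \<le> err n"
  shows "Liminf (at s within {0..1}) (\<lambda>t. ereal (f t)) = liminf (\<lambda>n. ereal (h n)) \<and>
         Limsup (at s within {0..1}) (\<lambda>t. ereal (f t)) = limsup (\<lambda>n. ereal (h n))"
proof -
  let ?F = "at s within {0..1}"
  have F: "?F \<noteq> bot"
    using s by (simp add: trivial_limit_within)
  define \<nu> where "\<nu> = (\<lambda>t. scale \<bar>t - s\<bar>)"
  have near: "\<forall>\<^sub>F t in ?F. t \<in> {0..1} \<and> 0 < \<bar>t - s\<bar> \<and> \<bar>t - s\<bar> < r" if "0 < r" for r
    using that by (auto simp: eventually_at dist_real_def)
  have \<nu>: "2 / 2 ^ \<nu> t \<le> \<bar>t - s\<bar>" "\<bar>t - s\<bar> < 4 / 2 ^ \<nu> t" if "0 < \<bar>t - s\<bar>" "\<bar>t - s\<bar> < 1" for t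
    using scale_bounds[of "\<bar>t - s\<bar>"] that by (auto simp: \<nu>_def)
  have ev_\<nu>: "\<forall>\<^sub>F t in ?F. m \<le> \<nu> t" for m
  proof -
    have "\<forall>\<^sub>F t in ?F. t \<in> {0..1} \<and> 0 < \<bar>t - s\<bar> \<and> \<bar>t - s\<bar> < min 1 (2 / 2 ^ m)"
      by (rule near) simp
    then show ?thesis
    proof eventually_elim
      case (elim t)
      then have "2 / 2 ^ \<nu> t < (2 / 2 ^ m :: real)" using \<nu>(1)[of t] by simp
      then have "(2::real) ^ m < 2 ^ \<nu> t" by (simp add: field_simps)
      then show "m \<le> \<nu> t" by simp
    qed
  qed
  then have lim_\<nu>: "filterlim \<nu> sequentially ?F"
    by (simp add: filterlim_at_top)
  have "\<forall>\<^sub>F t in ?F. norm (h (\<nu> t) - f t) \<le> err (\<nu> t)"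
    using near[of 1, simplified] ev_\<nu>[of 3]
    by eventually_elim (use close \<nu> in \<open>auto simp: abs_minus_commute\<close>)
  moreover have "((\<lambda>t. err (\<nu> t)) \<longlongrightarrow> 0) ?F"
    using err lim_\<nu> by (rule filterlim_compose)
  ultimately have small_\<nu>: "((\<lambda>t. h (\<nu> t) - f t) \<longlongrightarrow> 0) ?F"
    by (rule Lim_null_comparison)
  define \<tau> where "\<tau> = (\<lambda>n::nat. if s \<le> 1/2 then s + 2 / 2 ^ n else s - 2 / 2 ^ n)"
  have \<tau>_dist: "\<bar>\<tau> n - s\<bar> = 2 / 2 ^ n" for n by (simp add: \<tau>_def)
  have \<tau>_unit: "\<tau> n \<in> {0..1}" if "3 \<le> n" for n
  proof -
    have "(2::real) ^ 3 \<le> 2 ^ n" using that by (intro power_increasing) auto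
    then have "2 / 2 ^ n \<le> (1/2 :: real)" by (simp add: divide_le_eq)
    moreover define e where "e = 2 / (2::real) ^ n"
    ultimately have "0 \<le> e" "e \<le> 1/2" by auto
    then show ?thesis using s by (auto simp: \<tau>_def simp flip: e_def)
  qed
  have pow_lim: "(\<lambda>n. 2 / 2 ^ n :: real) \<longlonglongrightarrow> 0"
  proof -
    have "(\<lambda>n. 2 * (1/2) ^ n :: real) \<longlonglongrightarrow> 0"
      by (intro tendsto_mult_right_zero LIMSEQ_power_zero) simp
    then show ?thesis by (simp add: power_one_over)
  qed
  have "(\<lambda>n. \<tau> n - s) \<longlonglongrightarrow> 0"
    by (rule Lim_null_comparison[OF _ pow_lim]) (simp add: \<tau>_dist)
  then have "\<tau> \<longlonglongrightarrow> s" by (simp add: LIM_zero_iff)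
  moreover have "\<forall>\<^sub>F n in sequentially. \<tau> n \<in> {0..1} \<and> \<tau> n \<noteq> s"
    using eventually_ge_at_top[of 3]
  proof eventually_elim
    case (elim n)
    then show ?case using \<tau>_unit[of n] \<tau>_dist[of n] by auto
  qed
  ultimately have lim_\<tau>: "filterlim \<tau> ?F sequentially"
    by (simp add: filterlim_at)
  have "\<forall>\<^sub>F n in sequentially. norm (f (\<tau> n) - h n) \<le> err n"
    using eventually_ge_at_top[of 3]
    by eventually_elim (use close \<tau>_unit \<tau>_dist in \<open>simp add: divide_strict_right_mono\<close>)
  then have small_\<tau>: "(\<lambda>n. f (\<tau> n) - h n) \<longlonglongrightarrow> 0"
    using err by (rule Lim_null_comparison)
  show ?thesis
    using Limsup_le_of_asymptotic[OF lim_\<nu> small_\<nu> F]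
      Limsup_le_of_asymptotic[OF lim_\<tau> small_\<tau> sequentially_bot]
      Liminf_ge_of_asymptotic[OF lim_\<nu> small_\<nu> F]
      Liminf_ge_of_asymptotic[OF lim_\<tau> small_\<tau> sequentially_bot]
    by (auto intro: antisym)
qed

text \<open>Passing from \<open>m\<close> to \<open>G\<close> and from \<open>(1/2) ^ n\<close> to \<open>d\<close> changes both logarithms by a bounded amount,
  whereas the denominators grow linearly in \<open>n\<close>. The linear bound on \<open>ln m\<close> keeps the quotient
  bounded, so that the change of denominator is harmless too.\<close>

lemma log_ratio_close:
  fixes c C m G d R :: real and n :: nat
  assumes cC: "0 < c" "0 < C" and m: "0 < m" "\<bar>ln m\<bar> \<le> R * real n" and n: "3 \<le> n"
    and d: "2 / 2 ^ n \<le> d" "d < 4 / 2 ^ n" and G: "c * m \<le> G" "G \<le> C * m"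
  shows "\<bar>ln G / ln d - ln m / (real n * ln (1/2))\<bar>
         \<le> (2 * R + \<bar>ln c\<bar> + \<bar>ln C\<bar>) / ((real n - 2) * ln 2)"
proof -
  define y where "y = - ln d"
  define r where "r = ln m / (real n * ln 2)"
  have "0 < d" using d(1) by (rule less_le_trans[rotated]) simp
  have "ln (2 / 2 ^ n) \<le> ln d" using d(1) \<open>0 < d\<close> by simp
  then have y1: "y \<le> real n * ln 2 - ln 2"
    by (simp add: y_def ln_div ln_realpow)
  have "ln d < ln (4 / 2 ^ n)" using d(2) \<open>0 < d\<close> by simp
  moreover have "ln 4 = 2 * ln (2::real)" using ln_realpow[of "2::real" 2] by simp
  ultimately have y2: "(real n - 2) * ln 2 < y"
    by (simp add: y_def ln_div ln_realpow algebra_simps)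
  have l2: "0 < ln (2::real)" by simp
  have pos: "0 < (real n - 2) * ln 2" using n by simp
  have r: "\<bar>r\<bar> * ln 2 \<le> R"
    using m(2) n by (simp add: r_def abs_mult field_simps)
  have "0 < c * m" using cC(1) m(1) by simp
  then have "0 < G" using G(1) by linarith
  have "ln (c * m) \<le> ln G" using G(1) \<open>0 < c * m\<close> \<open>0 < G\<close> by simp
  moreover have "ln G \<le> ln (C * m)" using G(2) \<open>0 < G\<close> cC(2) m(1) by simp
  moreover have "ln (c * m) = ln c + ln m" "ln (C * m) = ln C + ln m"
    using cC m(1) by (simp_all add: ln_mult_pos)
  ultimately have lG: "\<bar>ln m - ln G\<bar> \<le> \<bar>ln c\<bar> + \<bar>ln C\<bar>"
    by linarith
  have ry: "\<bar>r * (y - real n * ln 2)\<bar> \<le> 2 * R"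
  proof -
    have "\<bar>y - real n * ln 2\<bar> \<le> 2 * ln 2"
      using y1 y2 l2 by (simp add: algebra_simps abs_if)
    then have "\<bar>r\<bar> * \<bar>y - real n * ln 2\<bar> \<le> \<bar>r\<bar> * (2 * ln 2)"
      by (intro mult_left_mono) auto
    then show ?thesis using r by (simp add: abs_mult)
  qed
  have "ln G / ln d - ln m / (real n * ln (1/2)) = r - ln G / y"
    by (simp add: y_def r_def ln_div)
  also have "\<dots> = (r * (y - real n * ln 2) + (ln m - ln G)) / y"
  proof -
    have "r * (real n * ln 2) = ln m" using n by (simp add: r_def)
    then show ?thesis
      using y2 pos by (simp add: right_diff_distrib diff_divide_distrib add_divide_distrib)
  qed
  also have "\<bar>\<dots>\<bar> \<le> (2 * R + \<bar>ln c\<bar> + \<bar>ln C\<bar>) / y"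
    using ry lG y2 pos by (simp add: abs_divide divide_right_mono)
  also have "\<dots> \<le> (2 * R + \<bar>ln c\<bar> + \<bar>ln C\<bar>) / ((real n - 2) * ln 2)"
  proof (rule divide_left_mono)
    show "0 \<le> 2 * R + \<bar>ln c\<bar> + \<bar>ln C\<bar>" using ry by linarith
    show "0 < y * ((real n - 2) * ln 2)"
      using less_trans[OF pos y2] pos by (rule mult_pos_pos)
  qed (use y2 in simp)
  finally show ?thesis .
qed

theorem proposition9:
  fixes u :: "real \<Rightarrow> real^3"
    and N :: "real^3 \<Rightarrow> real"
    and N' :: "(real^3 \<Rightarrow> real^3) \<Rightarrow> real"
    and s :: real
    and a :: "nat \<Rightarrow> nat"
  assumes "is_curve u"
    and "norm_R3 N"
    and "norm_End_H N'"
    and "s \<in> {0..1}"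
    and "lower_binary_expansion a s \<or> upper_binary_expansion a s"
  shows "alpha_inf N u s =
           liminf (\<lambda>n. ereal (ln (N' (Mvec_word (map a [1..<Suc n]))) / (real n * ln (1/2)))) \<and>
         alpha_sup N u s =
           limsup (\<lambda>n. ereal (ln (N' (Mvec_word (map a [1..<Suc n]))) / (real n * ln (1/2))))"
proof -
  interpret curve u by unfold_locales fact
  have digits: "binary_digits a s"
    using assms(5) by (auto simp: lower_binary_expansion_def upper_binary_expansion_def)
  define word where "word = (\<lambda>n. map a [1..<Suc n])"
  define w where "w = (\<lambda>n. width (Mvec_word (word n) chord))"
  define m where "m = (\<lambda>n. N' (Mvec_word (word n)))"
  obtain c C where cC: "0 < c" "0 < C"
    "\<And>v. v \<in> sector \<Longrightarrow> c * width v \<le> N v" "\<And>v. v \<in> sector \<Longrightarrow> N v \<le> C * width v"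
    using norm_R3_width_bounds[OF assms(2)] by metis
  obtain b B where bB: "0 < b" "0 < B"
    "\<And>f. \<lbrakk>f \<in> End_H; f ` sector \<subseteq> sector\<rbrakk> \<Longrightarrow> b * width (f chord) \<le> N' f"
    "\<And>f. \<lbrakk>f \<in> End_H; f ` sector \<subseteq> sector\<rbrakk> \<Longrightarrow> N' f \<le> B * width (f chord)"
    using norm_End_H_width_bounds[OF assms(3)] by metis
  have m_bounds: "b * w n \<le> m n" "m n \<le> B * w n" for n
    using bB(3,4)[OF Mvec_word_in_End_H Mvec_word_sector] by (simp_all add: m_def w_def)
  define k where "k = (\<lambda>n. dyadic_index (word n))"
  have word: "set (word n) \<subseteq> {0, 1}" "length (word n) = n" for n
    using digits by (auto simp: word_def binary_digits_def)
  have k: "k n < 2 ^ n" "real (k n) / 2 ^ n \<le> s" "s \<le> real (Suc (k n)) / 2 ^ n"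
    "w n = width (increment n (k n))" for n
    using dyadic_index_less[OF word(1)[of n]] increment_dyadic_index[OF word(1)[of n]]
      dyadic_interval_of_digits[OF digits, of n]
    by (simp_all add: word(2) k_def w_def) (simp_all add: word_def)
  have w_bounds: "2 * (2/5) ^ n \<le> w n" "w n \<le> 2" for n
  proof -
    have "(3/5 :: real) ^ n \<le> 1" by (rule power_le_one) auto
    then show "2 * (2/5) ^ n \<le> w n" "w n \<le> 2"
      using width_increment_bounds[OF k(1)[of n]] unfolding k(4) by auto
  qed
  have w_pos: "0 < w n" for n
    by (rule less_le_trans[OF _ w_bounds(1)]) simp
  have m_pos: "0 < m n" for n
    by (rule less_le_trans[OF _ m_bounds(1)]) (use bB(1) w_pos in simp)
  \<comment> \<open>The contraction rates \<open>2/5\<close> and \<open>3/5\<close> of the width confine \<open>m n\<close> between constant multiples of \<open>(2/5) ^ n\<close> and of 1.\<close>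
  define R where "R = \<bar>ln (2 * b)\<bar> + \<bar>ln (2 * B)\<bar> + ln (5/2)"
  have ln_m: "\<bar>ln (m n)\<bar> \<le> R * real n" if "3 \<le> n" for n
  proof -
    have "2 * b * (2/5) ^ n = b * (2 * (2/5) ^ n)" by simp
    also have "\<dots> \<le> b * w n"
      using w_bounds(1) bB(1) by (intro mult_left_mono) auto
    also have "\<dots> \<le> m n" by (rule m_bounds(1))
    finally have "ln (2 * b * (2/5) ^ n) \<le> ln (m n)"
      using bB(1) m_pos[of n] by simp
    moreover have "ln (2 * b * (2/5) ^ n) = ln (2 * b) - ln (5/2) * real n"
    proof -
      have "ln (2 * b * (2/5) ^ n) = ln (2 * b) + ln ((2/5) ^ n)"
        using bB(1) by (intro ln_mult_pos) auto
      also have "ln ((2/5 :: real) ^ n) = real n * ln (2/5)"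
        by (rule ln_realpow)
      also have "ln (2/5 :: real) = - ln (5/2)"
        by (simp add: ln_div)
      finally show ?thesis by simp
    qed
    moreover have "m n \<le> 2 * B"
      using m_bounds(2)[of n] mult_left_mono[OF w_bounds(2)[of n] less_imp_le[OF bB(2)]]
      by linarith
    then have "ln (m n) \<le> ln (2 * B)"
      using m_pos[of n] bB(2) by simp
    moreover have "0 \<le> ln (5/2 :: real)" by simp
    moreover have "\<bar>ln (2 * b)\<bar> \<le> \<bar>ln (2 * b)\<bar> * real n" "\<bar>ln (2 * B)\<bar> \<le> \<bar>ln (2 * B)\<bar> * real n"
      "0 \<le> ln (5/2 :: real) * real n"
      using that by (simp_all add: mult_le_cancel_left1)
    ultimately show ?thesis
      unfolding R_def distrib_right by linarith
  qed
  define c' C' where "c' = c / (4 * B)" and "C' = 1280 * C / b"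
  have cC': "0 < c'" "0 < C'" using cC bB by (simp_all add: c'_def C'_def)
  \<comment> \<open>The factor 4 in \<open>c'\<close> and the factor 1280 in \<open>C'\<close> come from \<open>width_at_scale\<close>; passing from the
    width to \<open>N'\<close> costs \<open>B\<close> and \<open>b\<close>.\<close>
  have N_bounds: "c' * m n \<le> N (u t - u s)" "N (u t - u s) \<le> C' * m n"
    if t: "t \<in> {0..1}" "2 / 2 ^ n \<le> \<bar>t - s\<bar>" "\<bar>t - s\<bar> < 4 / 2 ^ n" for n t
  proof -
    let ?v = "u (max s t) - u (min s t)"
    have eq: "N (u t - u s) = N ?v"
    proof (cases "s \<le> t")
      case False
      have "N ((- 1) *\<^sub>R (u s - u t)) = \<bar>- 1\<bar> * N (u s - u t)"
        using assms(2) unfolding norm_R3_def norm_on_def by blast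
      then show ?thesis using False by (simp add: max_def min_def)
    qed (simp add: max_def min_def)
    have v: "?v \<in> sector" using t(1) assms(4) by (intro u_increasing) auto
    note at_scale = width_at_scale[OF k(1-3) assms(4) t, folded k(4)]
    have N: "c * (1/4 * w n) \<le> N (u t - u s)" "N (u t - u s) \<le> C * (1280 * w n)"
      using order_trans[OF mult_left_mono[OF at_scale(1) less_imp_le[OF cC(1)]] cC(3)[OF v]]
        order_trans[OF cC(4)[OF v] mult_left_mono[OF at_scale(2) less_imp_le[OF cC(2)]]]
      by (simp_all only: eq)
    have "c' * m n \<le> c' * (B * w n)"
      using cC'(1) m_bounds(2) by (intro mult_left_mono) auto
    then show "c' * m n \<le> N (u t - u s)"
      using N(1) bB(2) by (simp add: c'_def)
    have "C' * (b * w n) \<le> C' * m n"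
      using cC'(2) m_bounds(1) by (intro mult_left_mono) auto
    then show "N (u t - u s) \<le> C' * m n"
      using N(2) bB(1) by (simp add: C'_def)
  qed
  define err where "err = (\<lambda>n. (2 * R + \<bar>ln c'\<bar> + \<bar>ln C'\<bar>) / ((real n - 2) * ln 2))"
  have "err \<longlonglongrightarrow> 0"
  proof (rule LIMSEQ_offset[of _ 2])
    have "(\<lambda>n. (2 * R + \<bar>ln c'\<bar> + \<bar>ln C'\<bar>) / ln 2 / real n) \<longlonglongrightarrow> 0"
      by (rule lim_const_over_n)
    then show "(\<lambda>n. err (n + 2)) \<longlonglongrightarrow> 0"
      by (simp add: err_def mult.commute)
  qed
  moreover have "\<bar>ln (N (u t - u s)) / ln \<bar>t - s\<bar> - ln (m n) / (real n * ln (1/2))\<bar> \<le> err n"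
    if "3 \<le> n" "t \<in> {0..1}" "2 / 2 ^ n \<le> \<bar>t - s\<bar>" "\<bar>t - s\<bar> < 4 / 2 ^ n" for n t
    unfolding err_def
    using cC' m_pos ln_m[OF that(1)] that(1,3,4) N_bounds[OF that(2-4)] by (rule log_ratio_close)
  ultimately show ?thesis
    unfolding alpha_inf_def alpha_sup_def m_def word_def
    by (rule limits_by_dyadic_scales[OF assms(4)])
qed

end
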